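(* Let $(X,d)$ be a complete bead space and let $F\colon X\to 2^{X}$ be a bounded mapping such that for some $\alpha<1$ the following holds: for each $x\in X$ there exists a $y\in F(x)$ with $d(F(y),y)\le\alpha\, d(F(x),x)$. Assume that for every regular sequence $(x_n)_{n\in\mathbb{N}}$ in $X$ with $\lim_{n\to\infty}d(F(x_n),x_n)=0$, if $\{x\}$ is the centre of $(x_n)_{n\in\mathbb{N}}$, then $F(x)$ is compact and $$F(x_n)\subset\overline{B}(F(x),d(x,x_n)),\quad n\in\mathbb{N}.$$ Then $F$ has a fixed point.
   Context: $2^{X}$ is the family of all subsets of $X$; a mapping $F\colon X\to 2^{X}$ is understood to satisfy $X\neq\emptyset$ and $F(x)\neq\emptyset$ for all $x\in X$. $F$ is bounded if $F(X)=\bigcup_{x\in X}F(x)$ is a bounded set. A fixed point is an $x\in X$ with $x\in F(x)$. For a nonempty set $A$, $d(A,y)=d(y,A)=\inf_{a\in A}d(a,y)$. $B(x,r)=\{y\in X\colon d(x,y)<r\}$ and, for $r\ge 0$, $\overline{B}(A,r)=\{y\in X\colon d(A,y)\le r\}$. Bead space: a metric space $(X,d)$ such that for every $r>0$, $\beta>0$ there exists a $\delta>0$ such that for each $x,y\in X$ with $d(x,y)\ge\beta$ there exists a $z\in X$ with $B(x,r+\delta)\cap B(y,r+\delta)\subset B(z,r-\delta)$. Let $(x_n)_{n\in\mathbb{N}}$ be a bounded sequence in $X$ and let $\mathcal{A}=\{A_n\colon n\in\mathbb{N}\}$ with $A_n=\{x_k\colon k\ge n\}$. Its (asymptotic) radius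 is $r((x_n)_{n\in\mathbb{N}})=\inf\{t\in(0,\infty)\colon \text{there exist } A\in\mathcal{A},\ z\in X \text{ with } A\subset B(z,t)\}$. Its (asymptotic) centre $c((x_n)_{n\in\mathbb{N}})$ is the set of all $x\in X$ such that $\inf\{t\in(0,\infty)\colon \text{there exists } A\in\mathcal{A} \text{ with } A\subset B(x,t)\}=r((x_n)_{n\in\mathbb{N}})$. Known fact: in a complete bead space the centre of any bounded sequence is a singleton. A bounded sequence $(x_n)_{n\in\mathbb{N}}$ is regular if $r((x_{k_n})_{n\in\mathbb{N}})=r((x_n)_{n\in\mathbb{N}})$ for each of its subsequences $(x_{k_n})_{n\in\mathbb{N}}$. *)

theory Defs
  imports "HOL-Analysis.Analysis"
begin

text \<open>Metric spaces are types of class \<^class>\<open>metric_space\<close>; they are nonempty, and \<open>X\<close> is the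
  whole type. For \<open>r \<le> \<delta>\<close> the ball of radius \<open>r - \<delta>\<close> below is empty.\<close>

class bead_space = metric_space +
  assumes bead:
    "r > 0 \<Longrightarrow> \<beta> > 0 \<Longrightarrow>
      \<exists>\<delta>>0. \<forall>x y. dist x y \<ge> \<beta> \<longrightarrow> (\<exists>z. ball x (r + \<delta>) \<inter> ball y (r + \<delta>) \<subseteq> ball z (r - \<delta>))"

definition tails :: "(nat \<Rightarrow> 'a) \<Rightarrow> 'a set set" where
  "tails x = {x ` {n..} |n. True}"

text \<open>For a bounded sequence the two infima below are taken over nonempty sets of positive reals.
  For unbounded sequences the sets are empty and the values have no meaning.\<close>

definition asymp_radius :: "(nat \<Rightarrow> 'a::metric_space) \<Rightarrow> real" where
  "asymp_radius x = Inf {t. 0 < t \<and> (\<exists>A\<in>tails x. \<exists>z. A \<subseteq> ball z t)}"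

definition asymp_centre :: "(nat \<Rightarrow> 'a::metric_space) \<Rightarrow> 'a set" where
  "asymp_centre x = {z. Inf {t. 0 < t \<and> (\<exists>A\<in>tails x. A \<subseteq> ball z t)} = asymp_radius x}"

definition regular_seq :: "(nat \<Rightarrow> 'a::metric_space) \<Rightarrow> bool" where
  "regular_seq x \<longleftrightarrow> bounded (range x) \<and>
    (\<forall>k::nat \<Rightarrow> nat. strict_mono k \<longrightarrow> asymp_radius (x \<circ> k) = asymp_radius x)"

text \<open>Meant for nonempty \<open>A\<close> only: \<^const>\<open>infdist\<close> to the empty set is \<open>0\<close> by convention.\<close>

definition cball_set :: "'a::metric_space set \<Rightarrow> real \<Rightarrow> 'a set" where
  "cball_set A r = {y. infdist y A \<le> r}"

end

theory Submission
  imports Defs "HOL-Library.Diagonal_Subsequence"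
begin

text \<open>Choosing \<open>g x \<in> F x\<close> so that the defect \<open>d(F(x), x)\<close> shrinks by the factor \<open>\<alpha>\<close> and
  iterating \<open>g\<close> gives a bounded sequence whose defects tend to \<open>0\<close>. A diagonal argument
  (\<open>regular_subseq_exists\<close>) extracts a regular subsequence \<open>y\<close>, and completeness together with the
  bead property gives it a single centre \<open>c\<close> (\<open>asymp_centre_singleton\<close>).

  The point \<open>c\<close> is fixed because \<open>F c\<close> contains a second candidate for a centre
  (\<open>centre_in_image\<close>). Since the defects vanish, \<open>y n\<close> is nearly a point of \<open>F (y n)\<close>, and every
  point of \<open>F (y n)\<close> lies within \<open>d(c, y n)\<close> of \<open>F c\<close>, up to an arbitrarily small error. Hence
  there are \<open>w n \<in> F c\<close> that are asymptotically no farther from \<open>y n\<close> than \<open>c\<close> is. By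
  compactness the \<open>w n\<close> cluster at some \<open>v \<in> F c\<close>; along the corresponding subsequence \<open>y \<circ> k\<close> the
  point \<open>v\<close> does at least as well as \<open>c\<close>. Regularity says that passing to \<open>y \<circ> k\<close> does not lower
  the radius, so \<open>c\<close> is still a centre there and \<open>v\<close> is one as well. Centres in a bead space are
  unique, so \<open>c = v \<in> F c\<close>.\<close>

section \<open>Asymptotic radius and centre through eventual inclusion in balls\<close>

lemma tail_in_ball_iff:
  "(\<exists>A\<in>tails x. A \<subseteq> ball z t) \<longleftrightarrow> (\<forall>\<^sub>F n in sequentially. dist z (x n) < t)"
proof -
  have "(\<exists>A\<in>tails x. A \<subseteq> ball z t) \<longleftrightarrow> (\<exists>N. x ` {N..} \<subseteq> ball z t)"
    unfolding tails_def by blast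
  then show ?thesis by (auto simp: eventually_sequentially image_subset_iff)
qed

lemma asymp_radius_alt:
  "asymp_radius x = Inf {t. 0 < t \<and> (\<exists>z. \<forall>\<^sub>F n in sequentially. dist z (x n) < t)}"
proof -
  have "(\<exists>A\<in>tails x. \<exists>z. A \<subseteq> ball z t) \<longleftrightarrow> (\<exists>z. \<forall>\<^sub>F n in sequentially. dist z (x n) < t)" for t
    using tail_in_ball_iff[of x _ t] by blast
  then show ?thesis unfolding asymp_radius_def by simp
qed

lemma eventually_dist_less_imp_pos:
  assumes "\<forall>\<^sub>F n in sequentially. dist z (x n) < t"
  shows "0 < t"
proof -
  obtain n where "dist z (x n) < t" using eventually_happens[OF assms] by auto
  then show ?thesis by (rule le_less_trans[OF zero_le_dist])
qed

lemma asymp_radius_le: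
  assumes "\<forall>\<^sub>F n in sequentially. dist z (x n) < t"
  shows "asymp_radius x \<le> t"
  unfolding asymp_radius_alt
  using assms eventually_dist_less_imp_pos[OF assms]
  by (intro cInf_lower) (auto intro!: bdd_belowI[of _ 0])

lemma bounded_range_imp_eventually_dist_less:
  assumes "bounded (range x)"
  shows "\<exists>t>0. \<forall>\<^sub>F n in sequentially. dist z (x n) < t"
proof -
  obtain e where "\<forall>y\<in>range x. dist z y \<le> e"
    using assms bounded_any_center[of "range x" z] by auto
  then have "dist z (x n) < e + 1" for n by (simp add: add.commute add_strict_increasing)
  then have "\<forall>\<^sub>F n in sequentially. dist z (x n) < e + 1" by simp
  then show ?thesis using eventually_dist_less_imp_pos by blast
qed

lemma asymp_radius_nonneg:
  assumes "bounded (range x)"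
  shows "0 \<le> asymp_radius x"
  unfolding asymp_radius_alt
  using bounded_range_imp_eventually_dist_less[OF assms, of undefined]
  by (intro cInf_greatest) (auto intro: less_imp_le)

lemma asymp_radius_lessD:
  assumes "bounded (range x)" "asymp_radius x < t"
  obtains z where "\<forall>\<^sub>F n in sequentially. dist z (x n) < t"
proof -
  let ?S = "{t. 0 < t \<and> (\<exists>z. \<forall>\<^sub>F n in sequentially. dist z (x n) < t)}"
  have ne: "?S \<noteq> {}"
    using bounded_range_imp_eventually_dist_less[OF assms(1), of undefined] by auto
  obtain s where "s \<in> ?S" "s < t"
    using cInf_lessD[OF ne assms(2)[unfolded asymp_radius_alt]] by blast
  then obtain z where "\<forall>\<^sub>F n in sequentially. dist z (x n) < s" by blast
  then have "\<forall>\<^sub>F n in sequentially. dist z (x n) < t"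
    by (rule eventually_mono) (use \<open>s < t\<close> in auto)
  then show thesis by (rule that)
qed

text \<open>For fixed \<open>z\<close> the infimum in the definition of the centre can never fall below the radius, so
  being in the centre only requires that the distances from \<open>z\<close> eventually stay below every
  number above the radius.\<close>

lemma mem_asymp_centre_iff:
  assumes "bounded (range x)"
  shows "z \<in> asymp_centre x \<longleftrightarrow>
    (\<forall>t>asymp_radius x. \<forall>\<^sub>F n in sequentially. dist z (x n) < t)"
proof -
  let ?S = "{t. 0 < t \<and> (\<forall>\<^sub>F n in sequentially. dist z (x n) < t)}"
  have centre: "z \<in> asymp_centre x \<longleftrightarrow> Inf ?S = asymp_radius x"
    unfolding asymp_centre_def by (simp add: tail_in_ball_iff)
  have ne: "?S \<noteq> {}"
    using bounded_range_imp_eventually_dist_less[OF assms, of z] by auto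
  have ge: "asymp_radius x \<le> Inf ?S"
    using ne by (intro cInf_greatest) (auto intro: asymp_radius_le)
  show ?thesis
  proof
    assume "z \<in> asymp_centre x"
    then have eq: "Inf ?S = asymp_radius x" by (simp add: centre)
    show "\<forall>t>asymp_radius x. \<forall>\<^sub>F n in sequentially. dist z (x n) < t"
    proof (intro allI impI)
      fix t assume "asymp_radius x < t"
      then obtain s where s: "s \<in> ?S" "s < t" using cInf_lessD[OF ne] eq by metis
      then have "\<forall>\<^sub>F n in sequentially. dist z (x n) < s" by blast
      then show "\<forall>\<^sub>F n in sequentially. dist z (x n) < t"
        by (rule eventually_mono) (use s in auto)
    qed
  next
    assume ev: "\<forall>t>asymp_radius x. \<forall>\<^sub>F n in sequentially. dist z (x n) < t"
    have "Inf ?S \<le> t" if "asymp_radius x < t" for t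
      using that ev eventually_dist_less_imp_pos[of z x t]
      by (intro cInf_lower) (auto intro!: bdd_belowI[of _ 0])
    then have "Inf ?S \<le> asymp_radius x" by (rule dense_ge)
    then show "z \<in> asymp_centre x" using ge by (simp add: centre)
  qed
qed

lemma asymp_radius_subseq_le:
  assumes "bounded (range x)" "strict_mono (k :: nat \<Rightarrow> nat)"
  shows "asymp_radius (x \<circ> k) \<le> asymp_radius x"
proof (rule dense_ge)
  fix t assume "asymp_radius x < t"
  then obtain z where "\<forall>\<^sub>F n in sequentially. dist z (x n) < t"
    using asymp_radius_lessD[OF assms(1)] by blast
  then have "\<forall>\<^sub>F n in sequentially. dist z ((x \<circ> k) n) < t"
    using eventually_subseq[OF assms(2)] by auto
  then show "asymp_radius (x \<circ> k) \<le> t" by (rule asymp_radius_le)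
qed

lemma asymp_radius_shift: "asymp_radius (x \<circ> (+) m) = asymp_radius x"
proof -
  have "(\<forall>\<^sub>F n in sequentially. dist z ((x \<circ> (+) m) n) < t)
      \<longleftrightarrow> (\<forall>\<^sub>F n in sequentially. dist z (x n) < t)" for z t
    using eventually_sequentially_seg[of "\<lambda>n. dist z (x n) < t" m]
    by (simp add: add.commute[of m])
  then show ?thesis unfolding asymp_radius_alt by (simp only:)
qed

section \<open>The centre of a bounded sequence in a complete bead space\<close>

text \<open>Two almost centres at distance at least \<open>\<beta>\<close> would, by the bead property at the radius \<open>r\<close>,
  trap a tail of the sequence in a ball of radius \<open>r - \<delta>\<close>, contradicting the minimality of \<open>r\<close>.
  The bead property says nothing at \<open>r = 0\<close>, but there the sequence itself is squeezed towards
  both points. This uniform statement gives both uniqueness of the centre and the Cauchy property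
  of minimizing sequences.\<close>

lemma bead_almost_centres_close:
  fixes x :: "nat \<Rightarrow> 'a::bead_space"
  assumes "bounded (range x)" "0 < \<beta>"
  shows "\<exists>\<delta>>0. \<forall>y z. (\<forall>\<^sub>F n in sequentially. dist y (x n) < asymp_radius x + \<delta>) \<longrightarrow>
    (\<forall>\<^sub>F n in sequentially. dist z (x n) < asymp_radius x + \<delta>) \<longrightarrow> dist y z < \<beta>"
proof (cases "asymp_radius x = 0")
  case True
  have "dist y z < \<beta>"
    if ev: "\<forall>\<^sub>F n in sequentially. dist y (x n) < asymp_radius x + \<beta> / 2"
      "\<forall>\<^sub>F n in sequentially. dist z (x n) < asymp_radius x + \<beta> / 2" for y z
  proof -
    obtain n where "dist y (x n) < \<beta> / 2" "dist z (x n) < \<beta> / 2"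
      using eventually_happens[OF eventually_conj[OF ev]] True by auto
    then show ?thesis by (rule dist_triangle_half_l)
  qed
  moreover have "0 < \<beta> / 2" using assms(2) by simp
  ultimately show ?thesis by blast
next
  case False
  let ?r = "asymp_radius x"
  have r_pos: "?r > 0" using False asymp_radius_nonneg[OF assms(1)] by simp
  obtain \<delta> where \<delta>: "0 < \<delta>"
    "\<forall>y z :: 'a. \<beta> \<le> dist y z \<longrightarrow> (\<exists>w. ball y (?r + \<delta>) \<inter> ball z (?r + \<delta>) \<subseteq> ball w (?r - \<delta>))"
    using bead[OF r_pos assms(2)] by blast
  have "dist y z < \<beta>"
    if ev: "\<forall>\<^sub>F n in sequentially. dist y (x n) < ?r + \<delta>"
      "\<forall>\<^sub>F n in sequentially. dist z (x n) < ?r + \<delta>" for y z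
  proof (rule ccontr)
    assume "\<not> dist y z < \<beta>"
    then have "\<beta> \<le> dist y z" by simp
    from \<delta>(2)[rule_format, OF this]
    obtain w where w: "ball y (?r + \<delta>) \<inter> ball z (?r + \<delta>) \<subseteq> ball w (?r - \<delta>)" ..
    have "\<forall>\<^sub>F n in sequentially. dist w (x n) < ?r - \<delta>"
      using eventually_conj[OF ev] by (rule eventually_mono) (use w in auto)
    then have "?r \<le> ?r - \<delta>" by (rule asymp_radius_le)
    then show False using \<delta>(1) by simp
  qed
  then show ?thesis using \<delta>(1) by blast
qed

lemma asymp_centre_unique:
  fixes x :: "nat \<Rightarrow> 'a::bead_space"
  assumes "bounded (range x)" "y \<in> asymp_centre x" "z \<in> asymp_centre x"
  shows "y = z"
proof (rule ccontr)
  assume "y \<noteq> z"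
  then have "0 < dist y z" by simp
  obtain \<delta> where "0 < \<delta>" and close:
    "\<forall>y' z'. (\<forall>\<^sub>F n in sequentially. dist y' (x n) < asymp_radius x + \<delta>) \<longrightarrow>
      (\<forall>\<^sub>F n in sequentially. dist z' (x n) < asymp_radius x + \<delta>) \<longrightarrow> dist y' z' < dist y z"
    using bead_almost_centres_close[OF assms(1) \<open>0 < dist y z\<close>] by blast
  have "dist y z < dist y z"
    by (rule close[rule_format]) (use assms \<open>0 < \<delta>\<close> in \<open>simp_all add: mem_asymp_centre_iff\<close>)
  then show False by simp
qed

text \<open>Points whose asymptotic distance from the sequence exceeds the radius by at most \<open>1 / (k + 1)\<close>
  form a Cauchy sequence because almost centres are close to each other, and its limit attains
  the radius.\<close>

lemma asymp_centre_singleton: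
  fixes x :: "nat \<Rightarrow> 'a::{bead_space, complete_space}"
  assumes bdd: "bounded (range x)"
  obtains c where "asymp_centre x = {c}"
proof -
  let ?r = "asymp_radius x"
  have "\<exists>z. \<forall>\<^sub>F n in sequentially. dist z (x n) < ?r + inverse (real (Suc k))" for k
    using asymp_radius_lessD[OF bdd, of "?r + inverse (real (Suc k))"] by auto
  then obtain z where
    z: "\<And>k. \<forall>\<^sub>F n in sequentially. dist (z k) (x n) < ?r + inverse (real (Suc k))"
    by metis
  have z_small: "\<exists>N. \<forall>k\<ge>N. \<forall>\<^sub>F n in sequentially. dist (z k) (x n) < ?r + \<delta>"
    if pos: "0 < \<delta>" for \<delta>
  proof -
    obtain N where N: "\<And>k. N \<le> k \<Longrightarrow> inverse (real (Suc k)) < \<delta>"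
      using order_tendstoD(2)[OF LIMSEQ_inverse_real_of_nat pos]
      unfolding eventually_sequentially by blast
    have "\<forall>\<^sub>F n in sequentially. dist (z k) (x n) < ?r + \<delta>" if "N \<le> k" for k
      using z[of k] by (rule eventually_mono) (use N[OF that] in auto)
    then show ?thesis by blast
  qed
  have "Cauchy z"
  proof (rule metric_CauchyI)
    fix \<beta> :: real assume "0 < \<beta>"
    obtain \<delta> where "0 < \<delta>" and close:
      "\<forall>y z. (\<forall>\<^sub>F n in sequentially. dist y (x n) < ?r + \<delta>) \<longrightarrow>
        (\<forall>\<^sub>F n in sequentially. dist z (x n) < ?r + \<delta>) \<longrightarrow> dist y z < \<beta>"
      using bead_almost_centres_close[OF bdd \<open>0 < \<beta>\<close>] by blast
    obtain N where N: "\<forall>k\<ge>N. \<forall>\<^sub>F n in sequentially. dist (z k) (x n) < ?r + \<delta>"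
      using z_small[OF \<open>0 < \<delta>\<close>] by blast
    have "dist (z m) (z n) < \<beta>" if "N \<le> m" "N \<le> n" for m n
      using close[rule_format, OF N[rule_format, OF that(1)] N[rule_format, OF that(2)]] .
    then show "\<exists>M. \<forall>m\<ge>M. \<forall>n\<ge>M. dist (z m) (z n) < \<beta>" by blast
  qed
  then obtain c where c: "z \<longlonglongrightarrow> c" unfolding Cauchy_convergent_iff convergent_def by blast
  have mem: "c \<in> asymp_centre x"
    unfolding mem_asymp_centre_iff[OF bdd]
  proof (intro allI impI)
    fix t assume "?r < t"
    define \<delta> where "\<delta> = (t - ?r) / 2"
    have "0 < \<delta>" and t: "t = \<delta> + (?r + \<delta>)" using \<open>?r < t\<close> by (auto simp: \<delta>_def field_simps)
    obtain N where N: "\<And>k. k \<ge> N \<Longrightarrow> \<forall>\<^sub>F n in sequentially. dist (z k) (x n) < ?r + \<delta>"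
      using z_small[OF \<open>0 < \<delta>\<close>] by blast
    obtain M where M: "\<And>k. k \<ge> M \<Longrightarrow> dist (z k) c < \<delta>"
      using metric_LIMSEQ_D[OF c \<open>0 < \<delta>\<close>] by blast
    let ?k = "max N M"
    show "\<forall>\<^sub>F n in sequentially. dist c (x n) < t"
      using N[of ?k, OF max.cobounded1]
    proof (rule eventually_mono)
      fix n assume "dist (z ?k) (x n) < ?r + \<delta>"
      then show "dist c (x n) < t"
        using M[of ?k] dist_triangle[of c "x n" "z ?k"] by (simp add: dist_commute t)
    qed
  qed
  have "y = c" if "y \<in> asymp_centre x" for y using asymp_centre_unique[OF bdd that mem] .
  then have "asymp_centre x = {c}" using mem by blast
  then show thesis by (rule that)
qed

section \<open>Regular subsequences\<close>

text \<open>Call a subsequence \<open>n\<close>-good if no further subsequence lowers its radius by more than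
  \<open>1 / (n + 1)\<close>. Nearly minimizing the radius over all further subsequences shows that every
  subsequence has an \<open>n\<close>-good one, and \<open>n\<close>-goodness passes to further subsequences. A diagonal
  sequence is therefore \<open>n\<close>-good up to finitely many terms for every \<open>n\<close>; since the radius depends
  only on tails, no subsequence of it can lower the radius at all.\<close>

lemma regular_subseq_exists:
  fixes x :: "nat \<Rightarrow> 'a::metric_space"
  assumes bdd: "bounded (range x)"
  obtains k :: "nat \<Rightarrow> nat" where "strict_mono k" "regular_seq (x \<circ> k)"
proof -
  define P :: "nat \<Rightarrow> (nat \<Rightarrow> nat) \<Rightarrow> bool" where
    "P n s \<longleftrightarrow> (\<forall>k. strict_mono k \<longrightarrow>
      asymp_radius (x \<circ> s) \<le> asymp_radius (x \<circ> (s \<circ> k)) + inverse (real (Suc n)))" for n s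
  have bdd_sub: "bounded (range (x \<circ> s))" for s :: "nat \<Rightarrow> nat"
    using bdd by (rule bounded_subset) auto
  have P_refine: "\<exists>r. strict_mono r \<and> P n (s \<circ> r)" for n :: nat and s :: "nat \<Rightarrow> nat"
  proof -
    let ?R = "(\<lambda>k. asymp_radius (x \<circ> (s \<circ> k))) ` {k. strict_mono k}"
    have ne: "?R \<noteq> {}" using strict_mono_id by blast
    have bb: "bdd_below ?R"
      using asymp_radius_nonneg[OF bdd_sub] by (auto intro!: bdd_belowI[of _ 0])
    have "Inf ?R < Inf ?R + inverse (real (Suc n))" by simp
    then obtain r where r: "strict_mono r"
      "asymp_radius (x \<circ> (s \<circ> r)) < Inf ?R + inverse (real (Suc n))"
      using cInf_lessD[OF ne] by blast
    have "P n (s \<circ> r)"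
      unfolding P_def
    proof (intro allI impI)
      fix k :: "nat \<Rightarrow> nat" assume "strict_mono k"
      then have "Inf ?R \<le> asymp_radius (x \<circ> (s \<circ> (r \<circ> k)))"
        using bb r(1) by (intro cInf_lower) (auto intro: strict_mono_o)
      then show "asymp_radius (x \<circ> (s \<circ> r))
          \<le> asymp_radius (x \<circ> (s \<circ> r \<circ> k)) + inverse (real (Suc n))"
        using r(2) by (simp add: comp_assoc)
    qed
    then show ?thesis using r(1) by blast
  qed
  interpret subseqs P by unfold_locales (use P_refine in blast)
  let ?y = "x \<circ> diagseq"
  have diag: "P n (diagseq \<circ> (+) (Suc n))" for n
  proof (rule diagseq_holds)
    fix n :: nat and s k :: "nat \<Rightarrow> nat"
    assume k: "strict_mono k" and s: "P n s"
    show "P n (s \<circ> k)"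
      unfolding P_def
    proof (intro allI impI)
      fix l :: "nat \<Rightarrow> nat" assume l: "strict_mono l"
      have "asymp_radius (x \<circ> (s \<circ> k)) \<le> asymp_radius (x \<circ> s)"
        using asymp_radius_subseq_le[OF bdd_sub k, of s] by (simp add: comp_assoc)
      also have "\<dots> \<le> asymp_radius (x \<circ> (s \<circ> (k \<circ> l))) + inverse (real (Suc n))"
        using s strict_mono_o[OF k l] unfolding P_def by blast
      finally show "asymp_radius (x \<circ> (s \<circ> k))
          \<le> asymp_radius (x \<circ> (s \<circ> k \<circ> l)) + inverse (real (Suc n))"
        by (simp add: comp_assoc)
    qed
  qed
  have "asymp_radius (?y \<circ> k) = asymp_radius ?y" if k: "strict_mono k" for k
  proof (rule antisym)
    show "asymp_radius (?y \<circ> k) \<le> asymp_radius ?y"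
      using asymp_radius_subseq_le[OF bdd_sub k] .
    have bound: "asymp_radius ?y \<le> asymp_radius (?y \<circ> k) + inverse (real (Suc n))" for n
    proof -
      \<comment> \<open>The tail of \<open>y \<circ> k\<close> from \<open>Suc n\<close> on is the subsequence \<open>l\<close> of the \<open>n\<close>-good tail of \<open>y\<close>.\<close>
      define l where "l i = k (Suc n + i) - Suc n" for i
      have k_ge: "Suc n + i \<le> k (Suc n + i)" for i using strict_mono_imp_increasing[OF k] .
      have l: "k (Suc n + i) = Suc n + l i" for i using k_ge[of i] unfolding l_def by simp
      have "strict_mono l"
      proof (rule strict_monoI)
        fix i j :: nat assume "i < j"
        then have "k (Suc n + i) < k (Suc n + j)" using k by (simp add: strict_mono_less)
        then show "l i < l j" using l by simp
      qed
      then have "asymp_radius (x \<circ> (diagseq \<circ> (+) (Suc n)))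
          \<le> asymp_radius (x \<circ> (diagseq \<circ> (+) (Suc n) \<circ> l)) + inverse (real (Suc n))"
        using diag[of n] unfolding P_def by blast
      moreover have "x \<circ> (diagseq \<circ> (+) (Suc n) \<circ> l) = (?y \<circ> k) \<circ> (+) (Suc n)"
      proof
        fix i show "(x \<circ> (diagseq \<circ> (+) (Suc n) \<circ> l)) i = ((?y \<circ> k) \<circ> (+) (Suc n)) i"
          unfolding comp_apply l ..
      qed
      ultimately show ?thesis
        using asymp_radius_shift[of ?y "Suc n"] asymp_radius_shift[of "?y \<circ> k" "Suc n"]
        by (simp add: comp_assoc)
    qed
    have "(\<lambda>n. asymp_radius (?y \<circ> k) + inverse (real (Suc n))) \<longlonglongrightarrow> asymp_radius (?y \<circ> k) + 0"
      by (intro tendsto_intros LIMSEQ_inverse_real_of_nat)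
    then show "asymp_radius ?y \<le> asymp_radius (?y \<circ> k)"
      using LIMSEQ_le_const[of _ _ "asymp_radius ?y"] bound by auto
  qed
  then have "regular_seq ?y" unfolding regular_seq_def using bdd_sub by blast
  then show thesis using that subseq_diagseq by blast
qed

section \<open>The fixed point\<close>

lemma infdist_approx:
  assumes "A \<noteq> {}" "0 < e"
  obtains a where "a \<in> A" "dist x a < infdist x A + e"
proof -
  have "Inf (dist x ` A) < infdist x A + e" using assms by (simp add: infdist_notempty)
  then obtain s where "s \<in> dist x ` A" "s < infdist x A + e"
    using cInf_lessD[of "dist x ` A"] assms(1) by blast
  then show thesis using that by blast
qed

text \<open>Along the orbit of a selection of \<open>F\<close> that contracts the defect, the defects decay
  geometrically, and the orbit stays in the bounded set \<open>F(X)\<close> after its first term.\<close>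

lemma asymptotic_fixed_points_exist:
  fixes F :: "'a::metric_space \<Rightarrow> 'a set" and \<alpha> :: real
  assumes bdd: "bounded (\<Union>x. F x)" and "\<alpha> < 1"
    and step: "\<And>x. \<exists>y\<in>F x. infdist y (F y) \<le> \<alpha> * infdist x (F x)"
  obtains x :: "nat \<Rightarrow> 'a" where "bounded (range x)" "(\<lambda>n. infdist (x n) (F (x n))) \<longlonglongrightarrow> 0"
proof -
  obtain g where g: "\<And>x. g x \<in> F x" "\<And>x. infdist (g x) (F (g x)) \<le> \<alpha> * infdist x (F x)"
    using step by metis
  define x where "x n = (g ^^ n) undefined" for n
  \<comment> \<open>A negative \<open>\<alpha>\<close> cannot be iterated in inequalities and may have diverging powers.\<close>
  define a where "a = max \<alpha> 0"
  have a: "0 \<le> a" "a < 1" "\<alpha> \<le> a" using \<open>\<alpha> < 1\<close> by (auto simp: a_def)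
  have "range x \<subseteq> insert undefined (\<Union>x. F x)"
  proof (rule image_subsetI)
    fix n show "x n \<in> insert undefined (\<Union>x. F x)"
      using g(1) by (cases n) (auto simp: x_def)
  qed
  moreover have "bounded (insert undefined (\<Union>x. F x))" using bdd by simp
  ultimately have "bounded (range x)" using bounded_subset by blast
  moreover have "(\<lambda>n. infdist (x n) (F (x n))) \<longlonglongrightarrow> 0"
  proof (rule tendsto_sandwich[OF _ _ tendsto_const])
    have "infdist (x n) (F (x n)) \<le> infdist (x 0) (F (x 0)) * a ^ n" for n
    proof (induction n)
      case (Suc n)
      have "infdist (x (Suc n)) (F (x (Suc n))) \<le> \<alpha> * infdist (x n) (F (x n))"
        using g(2)[of "x n"] by (simp add: x_def)
      also have "\<dots> \<le> a * infdist (x n) (F (x n))"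
        using a(3) infdist_nonneg by (rule mult_right_mono)
      also have "\<dots> \<le> a * (infdist (x 0) (F (x 0)) * a ^ n)"
        using Suc.IH a(1) by (rule mult_left_mono)
      finally show ?case by (simp add: mult_ac)
    qed simp
    then show "\<forall>\<^sub>F n in sequentially. infdist (x n) (F (x n)) \<le> infdist (x 0) (F (x 0)) * a ^ n"
      by simp
    show "(\<lambda>n. infdist (x 0) (F (x 0)) * a ^ n) \<longlonglongrightarrow> 0"
      using a by (intro tendsto_mult_right_zero LIMSEQ_realpow_zero)
  qed (simp add: infdist_nonneg)
  ultimately show thesis by (rule that)
qed

text \<open>Asymptotic distances from \<open>c\<close> cannot grow on a subsequence, while by regularity the radius
  stays the same.\<close>

lemma asymp_centre_regular_subseq:
  assumes "regular_seq y" "strict_mono (k :: nat \<Rightarrow> nat)" "c \<in> asymp_centre y"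
  shows "c \<in> asymp_centre (y \<circ> k)"
proof -
  have bdd: "bounded (range y)" using assms(1) by (simp add: regular_seq_def)
  have bdd': "bounded (range (y \<circ> k))" using bdd by (rule bounded_subset) auto
  have eq: "asymp_radius (y \<circ> k) = asymp_radius y"
    using assms(1,2) by (simp add: regular_seq_def)
  show ?thesis
    using assms(3) eventually_subseq[OF assms(2)]
    unfolding mem_asymp_centre_iff[OF bdd] mem_asymp_centre_iff[OF bdd'] eq comp_apply
    by blast
qed

text \<open>The vanishing defects and the inclusion hypothesis yield points of \<open>F c\<close> that are
  asymptotically as close to \<open>y\<close> as \<open>c\<close> is; a cluster point of them is a centre of a subsequence
  of \<open>y\<close>, of which \<open>c\<close> is the only centre.\<close>

lemma centre_in_image:
  fixes F :: "'a::bead_space \<Rightarrow> 'a set"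
  assumes ne: "\<And>x. F x \<noteq> {}"
    and reg: "regular_seq y"
    and lim: "(\<lambda>n. infdist (y n) (F (y n))) \<longlonglongrightarrow> 0"
    and c: "c \<in> asymp_centre y"
    and cpt: "compact (F c)"
    and sub: "\<And>n. F (y n) \<subseteq> cball_set (F c) (dist c (y n))"
  shows "c \<in> F c"
proof -
  define e where "e n = inverse (real (Suc n))" for n
  have e: "0 < e n" for n by (simp add: e_def)
  have e_lim: "e \<longlonglongrightarrow> 0" unfolding e_def by (rule LIMSEQ_inverse_real_of_nat)
  have "\<exists>w\<in>F c. dist (y n) w < infdist (y n) (F (y n)) + dist c (y n) + 2 * e n" for n
  proof -
    obtain z where z: "z \<in> F (y n)" "dist (y n) z < infdist (y n) (F (y n)) + e n"
      using infdist_approx[OF ne e] by metis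
    obtain w where w: "w \<in> F c" "dist z w < infdist z (F c) + e n"
      using infdist_approx[OF ne e] by metis
    have "infdist z (F c) \<le> dist c (y n)" using z(1) sub[of n] by (auto simp: cball_set_def)
    then have "dist (y n) w < infdist (y n) (F (y n)) + dist c (y n) + 2 * e n"
      using z(2) w(2) dist_triangle[of "y n" w z] by linarith
    then show ?thesis using w(1) by blast
  qed
  then obtain w where w: "\<And>n. w n \<in> F c"
    "\<And>n. dist (y n) (w n) < infdist (y n) (F (y n)) + dist c (y n) + 2 * e n" by metis
  obtain v k where v: "v \<in> F c" and k: "strict_mono (k :: nat \<Rightarrow> nat)" and wv: "(w \<circ> k) \<longlonglongrightarrow> v"
    using cpt w(1) unfolding compact_def by metis
  have bdd: "bounded (range y)" using reg by (simp add: regular_seq_def)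
  have bdd': "bounded (range (y \<circ> k))" using bdd by (rule bounded_subset) auto
  have c': "c \<in> asymp_centre (y \<circ> k)" using asymp_centre_regular_subseq[OF reg k c] .
  \<comment> \<open>A vanishing bound for the amount by which \<open>v\<close> is farther from \<open>y (k n)\<close> than \<open>c\<close> is.\<close>
  define h where "h n = infdist (y (k n)) (F (y (k n))) + 2 * e (k n) + dist (w (k n)) v" for n
  have h_lim: "h \<longlonglongrightarrow> 0"
  proof -
    have "h \<longlonglongrightarrow> 0 + 2 * 0 + 0"
      unfolding h_def
      using LIMSEQ_subseq_LIMSEQ[OF lim k] LIMSEQ_subseq_LIMSEQ[OF e_lim k]
        tendsto_dist_iff[THEN iffD1, OF wv]
      by (intro tendsto_intros) (simp_all add: comp_def)
    then show ?thesis by simp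
  qed
  have "v \<in> asymp_centre (y \<circ> k)"
    unfolding mem_asymp_centre_iff[OF bdd']
  proof (intro allI impI)
    let ?r = "asymp_radius (y \<circ> k)"
    fix t assume "?r < t"
    define d where "d = (t - ?r) / 2"
    have "0 < d" and t: "t = (?r + d) + d" using \<open>?r < t\<close> by (auto simp: d_def field_simps)
    have "\<forall>\<^sub>F n in sequentially. dist c ((y \<circ> k) n) < ?r + d"
      using c' \<open>0 < d\<close> by (simp add: mem_asymp_centre_iff[OF bdd'])
    moreover have "\<forall>\<^sub>F n in sequentially. h n < d"
      using order_tendstoD(2)[OF h_lim \<open>0 < d\<close>] .
    ultimately show "\<forall>\<^sub>F n in sequentially. dist v ((y \<circ> k) n) < t"
    proof eventually_elim
      case (elim n)
      have "dist v (y (k n)) \<le> dist (w (k n)) v + dist (y (k n)) (w (k n))"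
        by (metis dist_commute dist_triangle)
      then show ?case using elim w(2)[of "k n"] t by (simp add: h_def)
    qed
  qed
  then have "v = c" using asymp_centre_unique[OF bdd' _ c'] by blast
  then show ?thesis using v by simp
qed

theorem theorem2p5:
  fixes F :: "'a::{bead_space, complete_space} \<Rightarrow> 'a set" and \<alpha> :: real
  assumes "\<And>x. F x \<noteq> {}"
    and "bounded (\<Union>x. F x)"
    and "\<alpha> < 1"
    and "\<And>x. \<exists>y\<in>F x. infdist y (F y) \<le> \<alpha> * infdist x (F x)"
    and "\<And>(x :: nat \<Rightarrow> 'a) c. regular_seq x \<Longrightarrow> (\<lambda>n. infdist (x n) (F (x n))) \<longlonglongrightarrow> 0 \<Longrightarrow>
      asymp_centre x = {c} \<Longrightarrow>
      compact (F c) \<and> (\<forall>n. F (x n) \<subseteq> cball_set (F c) (dist c (x n)))"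
  shows "\<exists>x. x \<in> F x"
proof -
  obtain x where x: "bounded (range x)" "(\<lambda>n. infdist (x n) (F (x n))) \<longlonglongrightarrow> 0"
    using asymptotic_fixed_points_exist[OF assms(2,3,4)] by blast
  obtain k :: "nat \<Rightarrow> nat" where k: "strict_mono k" and reg: "regular_seq (x \<circ> k)"
    using regular_subseq_exists[OF x(1)] by blast
  have lim: "(\<lambda>n. infdist ((x \<circ> k) n) (F ((x \<circ> k) n))) \<longlonglongrightarrow> 0"
    using LIMSEQ_subseq_LIMSEQ[OF x(2) k] by (simp add: comp_def)
  obtain c where c: "asymp_centre (x \<circ> k) = {c}"
    using asymp_centre_singleton reg unfolding regular_seq_def by blast
  have "compact (F c)"
    and "\<And>n. F ((x \<circ> k) n) \<subseteq> cball_set (F c) (dist c ((x \<circ> k) n))"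
    using assms(5)[OF reg lim c] by blast+
  moreover have "c \<in> asymp_centre (x \<circ> k)" unfolding c by simp
  ultimately have "c \<in> F c" using centre_in_image[OF assms(1) reg lim] by blast
  then show ?thesis ..
qed

end
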